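(* In the setting described in the context, let $\{x^k=(u_0^k,(u_i^k)_i,(w_i^k)_i)\}_{k}$ be generated by the $(u,w)$-scheme. Let $E_1\subset\mathcal H$, $E_2\subset\mathcal H^{n-1}$, $E_3\subset\mathcal H^{n-1}$ be nonempty sets such that $E_1\times E_2\times E_3$ is bounded, and define the restricted primal-dual gap $$\Psi_{E_1\times E_2\times E_3}(x)=\sup_{(w_i')\in E_3}\mathcal L(u_0,u_i,w_i')-\inf_{(u_0',u_i')\in E_1\times E_2}\mathcal L(u_0',u_i',w_i),\qquad x=(u_0,(u_i)_i,(w_i)_i).$$ Then for every integer $K\ge1$, $$\Psi_{E_1\times E_2\times E_3}\Big(\frac1K\sum_{k=1}^Kx^k\Big)\le\frac1{2K}\sup_{x\in E_1\times E_2\times E_3}\|x^0-x\|_{\mathcal Q}^2 .$$ Furthermore, $\Psi_{E_1\times E_2\times E_3}\big(\frac1K\sum_{k=1}^Kx^k\big)\ge0$ if $E_1\times E_2\times E_3$ contains a saddle point $x^\star=(u_0^\star,(u_i^\star)_i,(w_i^\star)_i)$ of $\mathcal L$ such that $(u_0^\star,(u_i^\star)_i,(u_i^\star-w_i^\star)_i)\in\mathrm{Fix}\,\mathcal T_{uz}$.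
   Context: Notation: $[r]=\{1,\dots,r\}$; $n\ge2$; $\mathcal H$ is a real Hilbert space; $a\in\mathcal H$; $f_i:\mathcal H\to\mathbb R\cup\{+\infty\}$ ($i=0,\dots,n-1$) are proper, lower semicontinuous, convex. Problem: $\inf_{u\in\mathcal H}f_0(u)-\langle u|a\rangle+\sum_{i=1}^{n-1}f_i(u)$. Put $A_i=\partial f_i$. Standing assumption: there is $u$ with $a\in\sum_{i=0}^{n-1}\partial f_i(u)$. Tree: an arbitrary rooted tree with node set $\{0,\dots,n-1\}$, root $0$; $\mathrm{pa}(i)$ is the parent of $i\in[n-1]$, $\mathrm{ch}(i)$ the set of children of $i$. $M_i$ ($i\in[n-1]$) are linear, bounded, self-adjoint, uniformly positive definite operators on $\mathcal H$. $(u,w)$-scheme: from arbitrary $u_i^0,w_i^0\in\mathcal H$ ($i\in[n-1]$), $u_0^0\in\mathcal H$, for $k\ge0$ compute from root to leaves $0\in A_0u_0^{k+1}-a+\sum_{c\in\mathrm{ch}(0)}M_c(u_0^{k+1}-u_c^k+w_c^k)$; and for $i\in[n-1]$: $w_i^{k+1}=w_i^k-u_i^k+u_{\mathrm{pa}(i)}^{k+1}$ and $0\in A_iu_i^{k+1}+M_i(u_i^{k+1}-u_{\mathrm{pa}(i)}^{k+1}-w_i^{k+1})+\sum_{c\in\mathrm{ch}(i)}M_c(u_i^{k+1}-u_c^k+w_c^k)$. Lagrangian: $\mathcal L(u_0,u_i,w_i)=f_0(u_0)-\langle u_0|a\rangle+\sum_{i=1}^{n-1}f_i(u_i)+\sum_{i=1}^{n-1}\langle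 M_iw_i|u_{\mathrm{pa}(i)}-u_i\rangle$. $\mathcal Q$ is the self-adjoint positive semidefinite operator on $\mathcal H\times\mathcal H^{n-1}\times\mathcal H^{n-1}$ with $\|x\|_{\mathcal Q}^2=\langle x|\mathcal Qx\rangle=\sum_{i=1}^{n-1}\langle u_i-w_i|M_i(u_i-w_i)\rangle$ for $x=(u_0,(u_i)_i,(w_i)_i)$; i.e. the blocks $(u_i,u_i)$ and $(w_i,w_i)$ equal $M_i$, the blocks $(u_i,w_i),(w_i,u_i)$ equal $-M_i$, and all others are zero. $\mathcal T_{uz}$: for input $(v_0,(v_i)_i,(z_i)_i)$ compute from root to leaves $0\in A_0u_0-a+\sum_{c\in\mathrm{ch}(0)}M_c(u_0-z_c)$ and, for $i\in[n-1]$, $0\in A_iu_i+M_i(u_i+z_i-2u_{\mathrm{pa}(i)})+\sum_{c\in\mathrm{ch}(i)}M_c(u_i-z_c)$; the output is $(u_0,(u_i)_i,(z_i+u_i-u_{\mathrm{pa}(i)})_i)$. *)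

theory Defs
  imports "HOL-Analysis.Analysis"
begin

text \<open>
  The ambient real Hilbert space is a type of sort \<open>{real_inner, complete_space}\<close>.

  The index set of the non-root nodes, $\{1,\dots,n-1\}$ with $n \ge 2$, is a type \<open>'n\<close> of class
  \<open>finite\<close> (so $n$ is \<open>CARD('n) + 1\<close>, and $n \ge 2$ because types are nonempty).
  The node set $\{0,\dots,n-1\}$ is \<open>'n option\<close>: the root $0$ is \<open>None\<close>, the node $i \ge 1$ is \<open>Some i\<close>.
  A point $(u_0,(u_i)_i,(w_i)_i)$ is an element of the Hilbert space \<open>'a \<times> ('a ^ 'n) \<times> ('a ^ 'n)\<close>,
  with its product norm.
\<close>

subsection \<open>Extended-valued functions\<close>

definition proper_fun :: "('a \<Rightarrow> ereal) \<Rightarrow> bool" where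
  "proper_fun f \<longleftrightarrow> (\<forall>x. f x \<noteq> -\<infinity>) \<and> (\<exists>x. f x \<noteq> \<infinity>)"

definition lsc_fun :: "('a::topological_space \<Rightarrow> ereal) \<Rightarrow> bool" where
  "lsc_fun f \<longleftrightarrow> (\<forall>x. f x \<le> Liminf (at x) f)"

definition convex_fun :: "('a::real_vector \<Rightarrow> ereal) \<Rightarrow> bool" where
  "convex_fun f \<longleftrightarrow>
     (\<forall>x y. \<forall>t::real. 0 < t \<and> t < 1 \<longrightarrow>
        f ((1 - t) *\<^sub>R x + t *\<^sub>R y) \<le> ereal (1 - t) * f x + ereal t * f y)"

text \<open>For a proper \<open>f\<close> the subdifferential is empty wherever \<open>f x = \<infinity>\<close>.\<close>

definition subdifferential :: "('a::real_inner \<Rightarrow> ereal) \<Rightarrow> 'a \<Rightarrow> 'a set" where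
  "subdifferential f x = {g. \<forall>y. f x + ereal (g \<bullet> (y - x)) \<le> f y}"

subsection \<open>Operators\<close>

definition self_adjoint :: "('a::real_inner \<Rightarrow> 'a) \<Rightarrow> bool" where
  "self_adjoint M \<longleftrightarrow> (\<forall>x y. M x \<bullet> y = x \<bullet> M y)"

definition uniformly_positive :: "('a::real_inner \<Rightarrow> 'a) \<Rightarrow> bool" where
  "uniformly_positive M \<longleftrightarrow> (\<exists>c>0. \<forall>x. c * (norm x)\<^sup>2 \<le> x \<bullet> M x)"

subsection \<open>Rooted trees\<close>

text \<open>
  A rooted tree is given by its parent map; its directed edges go from \<open>pa i\<close> to \<open>Some i\<close>.
  By typing the root has no parent and every other node has exactly one, so the edges form
  a tree rooted at \<open>None\<close> iff every node is reachable from the root.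
\<close>

definition rooted_tree :: "('n \<Rightarrow> 'n option) \<Rightarrow> bool" where
  "rooted_tree pa \<longleftrightarrow> (\<forall>v. (None, v) \<in> {(pa i, Some i) | i. True}\<^sup>*)"

definition ch :: "('n \<Rightarrow> 'n option) \<Rightarrow> 'n option \<Rightarrow> 'n set" where
  "ch pa v = {c. pa c = v}"

text \<open>The component at node \<open>v\<close> of the family $(u_0,(u_i)_i)$.\<close>

definition at_node :: "'a \<Rightarrow> 'a ^ 'n \<Rightarrow> 'n option \<Rightarrow> 'a" where
  "at_node u0 u v = (case v of None \<Rightarrow> u0 | Some i \<Rightarrow> u $ i)"

subsection \<open>The scheme in the variables $(u,w)$\<close>

definition uw_step ::
  "('n option \<Rightarrow> 'a \<Rightarrow> ereal) \<Rightarrow> 'a \<Rightarrow> ('n \<Rightarrow> 'n option) \<Rightarrow> ('n \<Rightarrow> 'a \<Rightarrow> 'a) \<Rightarrow>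
   'a \<times> ('a ^ 'n) \<times> ('a ^ 'n) \<Rightarrow> 'a::real_inner \<times> ('a ^ 'n::finite) \<times> ('a ^ 'n) \<Rightarrow> bool" where
  "uw_step f a pa M x x' \<longleftrightarrow> (case (x, x') of ((u0, u, w), (u0', u', w')) \<Rightarrow>
     0 \<in> (\<lambda>g. g - a + (\<Sum>c\<in>ch pa None. M c (u0' - u $ c + w $ c))) ` subdifferential (f None) u0'
     \<and> (\<forall>i. w' $ i = w $ i - u $ i + at_node u0' u' (pa i))
     \<and> (\<forall>i. 0 \<in> (\<lambda>g. g + M i (u' $ i - at_node u0' u' (pa i) - w' $ i)
                    + (\<Sum>c\<in>ch pa (Some i). M c (u' $ i - u $ c + w $ c)))
                ` subdifferential (f (Some i)) (u' $ i)))"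

definition uw_scheme ::
  "('n option \<Rightarrow> 'a \<Rightarrow> ereal) \<Rightarrow> 'a \<Rightarrow> ('n \<Rightarrow> 'n option) \<Rightarrow> ('n \<Rightarrow> 'a \<Rightarrow> 'a) \<Rightarrow>
   (nat \<Rightarrow> 'a::real_inner \<times> ('a ^ 'n::finite) \<times> ('a ^ 'n)) \<Rightarrow> bool" where
  "uw_scheme f a pa M x \<longleftrightarrow> (\<forall>k. uw_step f a pa M (x k) (x (Suc k)))"

subsection \<open>Lagrangian, saddle points and the restricted primal-dual gap\<close>

definition Lagrangian ::
  "('n option \<Rightarrow> 'a \<Rightarrow> ereal) \<Rightarrow> 'a \<Rightarrow> ('n \<Rightarrow> 'n option) \<Rightarrow> ('n \<Rightarrow> 'a \<Rightarrow> 'a) \<Rightarrow>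
   'a \<Rightarrow> 'a::real_inner ^ 'n::finite \<Rightarrow> 'a ^ 'n \<Rightarrow> ereal" where
  "Lagrangian f a pa M u0 u w =
     f None u0 - ereal (u0 \<bullet> a) + (\<Sum>i\<in>UNIV. f (Some i) (u $ i))
     + ereal (\<Sum>i\<in>UNIV. M i (w $ i) \<bullet> (at_node u0 u (pa i) - u $ i))"

definition saddle_point ::
  "('n option \<Rightarrow> 'a \<Rightarrow> ereal) \<Rightarrow> 'a \<Rightarrow> ('n \<Rightarrow> 'n option) \<Rightarrow> ('n \<Rightarrow> 'a \<Rightarrow> 'a) \<Rightarrow>
   'a::real_inner \<Rightarrow> 'a ^ 'n::finite \<Rightarrow> 'a ^ 'n \<Rightarrow> bool" where
  "saddle_point f a pa M us0 us ws \<longleftrightarrow>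
     (\<forall>u0 u w. Lagrangian f a pa M us0 us w \<le> Lagrangian f a pa M us0 us ws
             \<and> Lagrangian f a pa M us0 us ws \<le> Lagrangian f a pa M u0 u ws)"

text \<open>
  In \<^typ>\<open>ereal\<close> the undefined difference \<open>\<infinity> - \<infinity>\<close> evaluates to \<open>\<infinity>\<close>.  It does not occur at averages
  of iterates with positive index: these lie in the domains of the functions, so the supremum
  over a bounded set is finite.
\<close>

definition restricted_gap ::
  "('n option \<Rightarrow> 'a \<Rightarrow> ereal) \<Rightarrow> 'a \<Rightarrow> ('n \<Rightarrow> 'n option) \<Rightarrow> ('n \<Rightarrow> 'a \<Rightarrow> 'a) \<Rightarrow>
   'a set \<Rightarrow> ('a ^ 'n) set \<Rightarrow> ('a ^ 'n) set \<Rightarrow>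
   'a::real_inner \<times> ('a ^ 'n::finite) \<times> ('a ^ 'n) \<Rightarrow> ereal" where
  "restricted_gap f a pa M E1 E2 E3 x = (case x of (u0, u, w) \<Rightarrow>
     (SUP w'\<in>E3. Lagrangian f a pa M u0 u w')
     - (INF (u0', u')\<in>E1 \<times> E2. Lagrangian f a pa M u0' u' w))"

subsection \<open>The operators $\mathcal Q$ and $\mathcal T_{uz}$\<close>

definition Q_op ::
  "('n \<Rightarrow> 'a \<Rightarrow> 'a) \<Rightarrow> 'a \<times> ('a ^ 'n) \<times> ('a ^ 'n) \<Rightarrow> 'a::real_inner \<times> ('a ^ 'n::finite) \<times> ('a ^ 'n)" where
  "Q_op M x = (case x of (u0, u, w) \<Rightarrow>
     (0, (\<chi> i. M i (u $ i) - M i (w $ i)), (\<chi> i. M i (w $ i) - M i (u $ i))))"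

definition Q_norm_sq ::
  "('n \<Rightarrow> 'a \<Rightarrow> 'a) \<Rightarrow> 'a::real_inner \<times> ('a ^ 'n::finite) \<times> ('a ^ 'n) \<Rightarrow> real" where
  "Q_norm_sq M x = x \<bullet> Q_op M x"

text \<open>
  \<open>T_uz\<close> is set-valued: it returns the set of all outputs that satisfy the inclusions.  For proper
  lsc convex functions and uniformly positive \<open>M i\<close> this set is a singleton (every node carries at
  least one of the metrics, so each inclusion is the evaluation of a resolvent).
  The component \<open>v\<close> of the input is not used.
\<close>

definition T_uz ::
  "('n option \<Rightarrow> 'a \<Rightarrow> ereal) \<Rightarrow> 'a \<Rightarrow> ('n \<Rightarrow> 'n option) \<Rightarrow> ('n \<Rightarrow> 'a \<Rightarrow> 'a) \<Rightarrow>
   'a::real_inner \<times> ('a ^ 'n::finite) \<times> ('a ^ 'n) \<Rightarrow> ('a \<times> ('a ^ 'n) \<times> ('a ^ 'n)) set" where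
  "T_uz f a pa M y = (case y of (v0, v, z) \<Rightarrow>
     {(u0, u, (\<chi> i. z $ i + u $ i - at_node u0 u (pa i))) | u0 u.
        0 \<in> (\<lambda>g. g - a + (\<Sum>c\<in>ch pa None. M c (u0 - z $ c))) ` subdifferential (f None) u0
        \<and> (\<forall>i. 0 \<in> (\<lambda>g. g + M i (u $ i + z $ i - 2 *\<^sub>R at_node u0 u (pa i))
                       + (\<Sum>c\<in>ch pa (Some i). M c (u $ i - z $ c)))
                   ` subdifferential (f (Some i)) (u $ i))})"

definition Fix :: "('b \<Rightarrow> 'b set) \<Rightarrow> 'b set" where
  "Fix T = {x. x \<in> T x}"

end

theory Submission
  imports Defs
begin

text \<open>
  The update of $w$ says $u_i^k - w_i^k = u_{\mathrm{pa}(i)}^{k+1} - w_i^{k+1}$, so the sum over the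
  children of a node in the inclusions is just $\sum_c M_c w_c^{k+1}$.  Put $s^k = u^k - w^k$.  Adding up
  the subgradient inequalities of all nodes at a comparison point $y = (v_0, v, q)$ and regrouping
  along the edges of the tree leaves
  $\mathcal L(u^{k+1}, q) - \mathcal L(v, w^{k+1})
    \le - \sum_i \langle M_i (s_i^k - s_i^{k+1}) | v_i - q_i - s_i^{k+1}\rangle$,
  which by the three-point identity is at most half the decrease of $\|x^k - y\|_{\mathcal Q}^2$.
  Telescoping and Jensen's inequality, with $\mathcal L$ convex in $(u_0, u)$ and affine in $w$,
  give the bound.
\<close>

section \<open>Sums over nodes and edges of the tree\<close>

lemma sum_option_UNIV:
  fixes g :: "'n::finite option \<Rightarrow> 'b::comm_monoid_add"
  shows "(\<Sum>v\<in>UNIV. g v) = g None + (\<Sum>i\<in>UNIV. g (Some i))"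
  by (simp add: UNIV_option_conv sum.reindex)

text \<open>Each non-root \<open>c\<close> is a child of exactly one node, \<open>pa c\<close>, so
  running over all nodes and their children visits every edge once, indexed by its lower
  end.\<close>

lemma sum_children:
  fixes h :: "'n::finite option \<Rightarrow> 'n \<Rightarrow> 'b::comm_monoid_add"
  shows "(\<Sum>c\<in>ch pa None. h None c) + (\<Sum>i\<in>UNIV. \<Sum>c\<in>ch pa (Some i). h (Some i) c)
    = (\<Sum>c\<in>UNIV. h (pa c) c)"
proof -
  have "(\<Sum>v\<in>UNIV. \<Sum>c\<in>{c \<in> UNIV. pa c = v}. h (pa c) c) = (\<Sum>c\<in>UNIV. h (pa c) c)"
    by (rule sum.group) auto
  then show ?thesis
    by (simp add: sum_option_UNIV ch_def)
qed

section \<open>Convex functions and subgradients\<close>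

text \<open>The epigraph of \<open>f\<close> is convex and contains the pairs
  \<open>(p i, r i)\<close>, hence also their convex combination. The real bounds \<open>r i\<close>
  keep the weighted sum free of infinite values.\<close>

lemma convex_fun_Jensen:
  assumes "convex_fun f" and "finite I" and "\<And>i. i \<in> I \<Longrightarrow> 0 \<le> c i" and "(\<Sum>i\<in>I. c i) = 1"
    and "\<And>i. i \<in> I \<Longrightarrow> f (p i) \<le> ereal (r i)"
  shows "f (\<Sum>i\<in>I. c i *\<^sub>R p i) \<le> ereal (\<Sum>i\<in>I. c i * r i)"
proof -
  let ?E = "{z. f (fst z) \<le> ereal (snd z)}"
  have "convex ?E"
    unfolding convex_alt
  proof (intro ballI allI impI)
    fix y z :: "'a \<times> real" and t :: real
    assume yz: "y \<in> ?E" "z \<in> ?E" and t: "0 \<le> t \<and> t \<le> 1"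
    show "(1 - t) *\<^sub>R y + t *\<^sub>R z \<in> ?E"
    \<comment> \<open>\<open>convex_fun\<close> speaks only of weights strictly between 0 and
      1.\<close>
    proof (cases "t = 0 \<or> t = 1")
      case True
      with yz show ?thesis by auto
    next
      case False
      with t have t': "0 < t \<and> t < 1" by auto
      have "f ((1 - t) *\<^sub>R fst y + t *\<^sub>R fst z) \<le> ereal (1 - t) * f (fst y) + ereal t * f (fst z)"
        using assms(1) t' unfolding convex_fun_def by blast
      also have "\<dots> \<le> ereal (1 - t) * ereal (snd y) + ereal t * ereal (snd z)"
        using yz t' by (intro add_mono ereal_mult_left_mono) auto
      finally show ?thesis by simp
    qed
  qed
  then have "(\<Sum>i\<in>I. c i *\<^sub>R (p i, r i)) \<in> ?E"
    using assms by (intro convex_sum) auto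
  then show ?thesis
    by (simp add: fst_sum snd_sum)
qed

text \<open>Were \<open>f x\<close> infinite, the subgradient inequality would force
  \<open>f\<close> to be infinite everywhere, against properness.\<close>

lemma subdifferential_finite:
  assumes "proper_fun f" and "g \<in> subdifferential f x"
  shows "f x \<noteq> \<infinity>" and "f x \<noteq> -\<infinity>"
proof -
  obtain y where "f y \<noteq> \<infinity>"
    using assms(1) by (auto simp: proper_fun_def)
  moreover have "f x + ereal (g \<bullet> (y - x)) \<le> f y"
    using assms(2) by (simp add: subdifferential_def)
  ultimately show "f x \<noteq> \<infinity>" by auto
  show "f x \<noteq> -\<infinity>" using assms(1) by (simp add: proper_fun_def)
qed

section \<open>The seminorm of the operator Q\<close>

text \<open>The blocks of \<open>Q_op\<close> combine into a form in the differences of the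
  \<open>u\<close> and \<open>w\<close> components alone; the root component drops out.\<close>

lemma Q_norm_sq_eq:
  "Q_norm_sq M (x - y) =
    (\<Sum>i\<in>UNIV. M i (fst (snd x) $ i - snd (snd x) $ i - (fst (snd y) $ i - snd (snd y) $ i))
      \<bullet> (fst (snd x) $ i - snd (snd x) $ i - (fst (snd y) $ i - snd (snd y) $ i)))"
  if "\<And>i. bounded_linear (M i)"
proof -
  have "linear (M i)" for i
    using that bounded_linear.linear by blast
  then show ?thesis
    unfolding Q_norm_sq_def Q_op_def split_def inner_prod_def fst_conv snd_conv inner_zero_right
      inner_vec_def add_0_left vec_lambda_beta sum.distrib[symmetric]
    by (intro sum.cong refl)
      (simp add: linear_diff inner_diff_left inner_diff_right inner_commute)
qed

lemma Q_norm_sq_nonneg: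
  assumes "\<And>i. bounded_linear (M i)" and "\<And>i. uniformly_positive (M i)"
  shows "0 \<le> Q_norm_sq M (x - y)"
proof -
  have "0 \<le> M i z \<bullet> z" for i z
  proof -
    obtain c where "c > 0" "c * (norm z)\<^sup>2 \<le> z \<bullet> M i z"
      using assms(2)[of i] unfolding uniformly_positive_def by blast
    then show ?thesis
      by (metis inner_commute mult_nonneg_nonneg order_trans less_imp_le zero_le_power2)
  qed
  then show ?thesis
    unfolding Q_norm_sq_eq[OF assms(1)] by (intro sum_nonneg)
qed

section \<open>The Lagrangian at finite and infinite values\<close>

text \<open>The value of the Lagrangian where the functions take the finite values \<open>F v\<close>.\<close>

definition Lagrangian_real ::
  "('n option \<Rightarrow> real) \<Rightarrow> 'a \<Rightarrow> ('n \<Rightarrow> 'n option) \<Rightarrow> ('n \<Rightarrow> 'a \<Rightarrow> 'a) \<Rightarrow>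
   'a \<Rightarrow> 'a::real_inner ^ 'n::finite \<Rightarrow> 'a ^ 'n \<Rightarrow> real" where
  "Lagrangian_real F a pa M u0 u w =
     (\<Sum>v\<in>UNIV. F v) - u0 \<bullet> a + (\<Sum>i\<in>UNIV. M i (w $ i) \<bullet> (at_node u0 u (pa i) - u $ i))"

text \<open>Here \<open>F\<close> may be any upper bounds, not only exact values; it is applied to
  the averaged values that Jensen's inequality supplies.\<close>

lemma Lagrangian_le_real:
  assumes "\<And>v. f v (at_node u0 u v) \<le> ereal (F v)"
  shows "Lagrangian f a pa M u0 u w \<le> ereal (Lagrangian_real F a pa M u0 u w)"
proof -
  have "f None u0 \<le> ereal (F None)"
    using assms[of None] by (simp add: at_node_def)
  moreover have "(\<Sum>i\<in>UNIV. f (Some i) (u $ i)) \<le> (\<Sum>i\<in>UNIV. ereal (F (Some i)))"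
    using assms[of "Some _"] by (intro sum_mono) (simp add: at_node_def)
  ultimately have "Lagrangian f a pa M u0 u w \<le> ereal (F None) - ereal (u0 \<bullet> a)
      + (\<Sum>i\<in>UNIV. ereal (F (Some i)))
      + ereal (\<Sum>i\<in>UNIV. M i (w $ i) \<bullet> (at_node u0 u (pa i) - u $ i))"
    unfolding Lagrangian_def by (intro add_mono ereal_minus_mono order_refl)
  then show ?thesis
    by (simp add: Lagrangian_real_def sum_option_UNIV algebra_simps)
qed

lemma Lagrangian_eq_real:
  assumes "\<And>v. f v (at_node u0 u v) = ereal (F v)"
  shows "Lagrangian f a pa M u0 u w = ereal (Lagrangian_real F a pa M u0 u w)"
  using assms[of None] assms[of "Some _"]
  by (simp add: at_node_def Lagrangian_def Lagrangian_real_def sum_option_UNIV algebra_simps)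

text \<open>No summand is \<open>-\<infinity>\<close>, so one infinite summand decides the value.
  This makes comparison points outside the domains harmless.\<close>

lemma Lagrangian_eq_PInfty:
  assumes "\<And>v. proper_fun (f v)" and "f v (at_node u0 u v) = \<infinity>"
  shows "Lagrangian f a pa M u0 u w = \<infinity>"
proof -
  have nm: "f v z \<noteq> -\<infinity>" for v z
    using assms(1) by (simp add: proper_fun_def)
  have nms: "(\<Sum>i\<in>UNIV. f (Some i) (u $ i)) \<noteq> -\<infinity>"
  proof -
    have "(\<Sum>i\<in>I. f (Some i) (u $ i)) \<noteq> -\<infinity>" if "finite I" for I
      using that by (induction I) (auto simp: nm)
    then show ?thesis by simp
  qed
  show ?thesis
  proof (cases v)
    case None
    then show ?thesis using assms(2) nms by (simp add: Lagrangian_def at_node_def)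
  next
    case (Some i)
    then have "(\<Sum>i\<in>UNIV. f (Some i) (u $ i)) = \<infinity>"
      using assms(2) by (auto simp: sum_Pinfty at_node_def)
    then show ?thesis using nm[of None u0] by (cases "f None u0") (auto simp: Lagrangian_def)
  qed
qed

section \<open>One step of the scheme\<close>

text \<open>Solves the inclusions for one subgradient per node, written in the new iterate only and
  indexed by \<open>'n option\<close>, so that the subgradient inequalities can be summed over all
  nodes at once.\<close>

lemma uw_step_subgradients:
  fixes M :: "'n::finite \<Rightarrow> 'a::real_inner \<Rightarrow> 'a"
  assumes step: "uw_step f a pa M (u0, u, w) (u0', u', w')"
    and M: "\<And>i. bounded_linear (M i)"
  obtains g where "\<And>v. g v \<in> subdifferential (f v) (at_node u0' u' v)"
    and "g None = a - (\<Sum>c\<in>ch pa None. M c (w' $ c))"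
    and "\<And>i. g (Some i) = M i (at_node u0' u' (pa i) + w' $ i - u' $ i)
                          - (\<Sum>c\<in>ch pa (Some i). M c (w' $ c))"
    and "\<And>i. w' $ i = w $ i - u $ i + at_node u0' u' (pa i)"
proof -
  have lin: "linear (M i)" for i
    using M bounded_linear.linear by blast
  have w: "w' $ i = w $ i - u $ i + at_node u0' u' (pa i)" for i
    using step by (simp add: uw_step_def)
  \<comment> \<open>For a child \<open>c\<close> of a node, \<open>pa c\<close> is that node, so the
    left side is the summand of \<open>c\<close> in the inclusion there.\<close>
  have c: "M c (at_node u0' u' (pa c) - u $ c + w $ c) = M c (w' $ c)" for c
    by (simp add: w algebra_simps)
  have c0: "(\<Sum>c\<in>ch pa None. M c (u0' - u $ c + w $ c)) = (\<Sum>c\<in>ch pa None. M c (w' $ c))"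
    by (rule sum.cong) (auto simp: ch_def c[symmetric] at_node_def)
  have ci: "(\<Sum>c\<in>ch pa (Some i). M c (u' $ i - u $ c + w $ c)) = (\<Sum>c\<in>ch pa (Some i). M c (w' $ c))"
    for i
    by (rule sum.cong) (auto simp: ch_def c[symmetric] at_node_def)
  obtain g0 where g0: "g0 \<in> subdifferential (f None) u0'"
      "g0 - a + (\<Sum>c\<in>ch pa None. M c (w' $ c)) = 0"
    using step unfolding uw_step_def c0[symmetric] by auto
  have "0 \<in> (\<lambda>g. g + M i (u' $ i - at_node u0' u' (pa i) - w' $ i) + (\<Sum>c\<in>ch pa (Some i). M c (w' $ c)))
      ` subdifferential (f (Some i)) (u' $ i)" for i
    using step unfolding uw_step_def ci[symmetric] prod.case by blast
  then have "\<exists>g\<in>subdifferential (f (Some i)) (u' $ i).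
      0 = g + M i (u' $ i - at_node u0' u' (pa i) - w' $ i) + (\<Sum>c\<in>ch pa (Some i). M c (w' $ c))" for i
    by (simp add: image_iff)
  then obtain gi where gi: "\<And>i. gi i \<in> subdifferential (f (Some i)) (u' $ i)"
      "\<And>i. 0 = gi i + M i (u' $ i - at_node u0' u' (pa i) - w' $ i) + (\<Sum>c\<in>ch pa (Some i). M c (w' $ c))"
    by metis
  have cancel: "y = n - s" if "0 = y + m + s" "n = - m" for y m n s :: 'a
  proof -
    have "y = (y + m + s) - m - s" by simp
    also have "\<dots> = n - s" unfolding that(1)[symmetric] that(2) by simp
    finally show ?thesis .
  qed
  define g where "g = (\<lambda>v. case v of None \<Rightarrow> g0 | Some i \<Rightarrow> gi i)"
  have "M i (at_node u0' u' (pa i) + w' $ i - u' $ i) = - M i (u' $ i - at_node u0' u' (pa i) - w' $ i)" for i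
    by (simp add: linear_diff[OF lin] linear_add[OF lin])
  then have "gi i = M i (at_node u0' u' (pa i) + w' $ i - u' $ i) - (\<Sum>c\<in>ch pa (Some i). M c (w' $ c))" for i
    by (rule cancel[OF gi(2)])
  moreover have "g v \<in> subdifferential (f v) (at_node u0' u' v)" for v
    using g0(1) gi(1) by (simp add: g_def at_node_def split: option.split)
  moreover have "g0 = a - (\<Sum>c\<in>ch pa None. M c (w' $ c))"
    using g0(2) by (simp add: algebra_simps)
  ultimately show ?thesis
    using w by (intro that[of g]) (auto simp: g_def)
qed

text \<open>Expand the form of \<open>M\<close> at \<open>s - t\<close>, split as
  \<open>(s - s') + (s' - t)\<close>; self-adjointness makes the two cross terms equal.\<close>

lemma self_adjoint_three_point:
  assumes "linear M" and "self_adjoint M"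
  shows "M (s - s') \<bullet> (t - s') =
    (M (s - s') \<bullet> (s - s') + M (s' - t) \<bullet> (s' - t) - M (s - t) \<bullet> (s - t)) / 2"
proof -
  have "M y \<bullet> z = M z \<bullet> y" for y z
    using assms(2) by (metis self_adjoint_def inner_commute)
  from this[of s s'] this[of s t] this[of s' t] show ?thesis
    by (simp add: linear_diff[OF assms(1)] inner_diff_left inner_diff_right)
qed

text \<open>The bound is a difference of consecutive squared distances to the same comparison point,
  so it telescopes over the steps.\<close>

lemma uw_step_gap:
  assumes step: "uw_step f a pa M x x'"
    and M: "\<And>i. bounded_linear (M i)" "\<And>i. self_adjoint (M i)" "\<And>i. uniformly_positive (M i)"
    and F: "\<And>v. f v (at_node (fst x') (fst (snd x')) v) = ereal (F v)"
    and G: "\<And>v. f v (at_node v0 v1 v) = ereal (G v)"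
  shows "Lagrangian_real F a pa M (fst x') (fst (snd x')) q
       - Lagrangian_real G a pa M v0 v1 (snd (snd x'))
     \<le> (Q_norm_sq M (x - (v0, v1, q)) - Q_norm_sq M (x' - (v0, v1, q))) / 2"
proof -
  obtain u0 u w where x: "x = (u0, u, w)" by (metis prod_cases3)
  obtain u0' u' w' where x': "x' = (u0', u', w')" by (metis prod_cases3)
  have lin: "linear (M i)" for i
    using M(1) bounded_linear.linear by blast
  obtain g where g: "\<And>v. g v \<in> subdifferential (f v) (at_node u0' u' v)"
    and g0: "g None = a - (\<Sum>c\<in>ch pa None. M c (w' $ c))"
    and gi: "\<And>i. g (Some i) = M i (at_node u0' u' (pa i) + w' $ i - u' $ i)
                          - (\<Sum>c\<in>ch pa (Some i). M c (w' $ c))"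
    and w: "\<And>i. w' $ i = w $ i - u $ i + at_node u0' u' (pa i)"
    using uw_step_subgradients[OF step[unfolded x x'] M(1)] by blast
  let ?p = "\<lambda>i. at_node u0' u' (pa i)" and ?y = "at_node v0 v1"
  let ?s = "\<lambda>i. u $ i - w $ i" and ?s' = "\<lambda>i. u' $ i - w' $ i" and ?t = "\<lambda>i. v1 $ i - q $ i"
  let ?d = "\<lambda>v. ?y v - at_node u0' u' v"
  have "F v + g v \<bullet> ?d v \<le> G v" for v
  proof -
    have "f v (at_node u0' u' v) + ereal (g v \<bullet> ?d v) \<le> f v (?y v)"
      using g[of v] by (simp add: subdifferential_def)
    then show ?thesis using F[of v] G[of v] by (simp add: x')
  qed
  then have "(\<Sum>v\<in>UNIV. F v) + (\<Sum>v\<in>UNIV. g v \<bullet> ?d v) \<le> (\<Sum>v\<in>UNIV. G v)"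
    unfolding sum.distrib[symmetric] by (intro sum_mono)
  \<comment> \<open>Each child sum in a subgradient becomes an edge term evaluated at the
    parent.\<close>
  moreover have "(\<Sum>v\<in>UNIV. g v \<bullet> ?d v) = a \<bullet> (v0 - u0')
      + (\<Sum>i\<in>UNIV. M i (?p i + w' $ i - u' $ i) \<bullet> (v1 $ i - u' $ i))
      - (\<Sum>i\<in>UNIV. M i (w' $ i) \<bullet> ?d (pa i))"
  proof -
    have "(\<Sum>v\<in>UNIV. g v \<bullet> ?d v) = a \<bullet> ?d None
      + (\<Sum>i\<in>UNIV. M i (?p i + w' $ i - u' $ i) \<bullet> ?d (Some i))
      - ((\<Sum>c\<in>ch pa None. M c (w' $ c) \<bullet> ?d None)
         + (\<Sum>i\<in>UNIV. \<Sum>c\<in>ch pa (Some i). M c (w' $ c) \<bullet> ?d (Some i)))"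
      unfolding sum_option_UNIV g0 gi inner_diff_left inner_sum_left sum_subtractf by simp
    then show ?thesis
      unfolding sum_children[of "\<lambda>v c. M c (w' $ c) \<bullet> ?d v"] by (simp add: at_node_def)
  qed
  \<comment> \<open>Once the terms in \<open>a\<close> cancel, the left side collects what remains
    of the subgradient terms and the two coupling sums.\<close>
  moreover have "(\<Sum>i\<in>UNIV. M i (?p i + w' $ i - u' $ i) \<bullet> (v1 $ i - u' $ i))
      - (\<Sum>i\<in>UNIV. M i (w' $ i) \<bullet> ?d (pa i))
      + (\<Sum>i\<in>UNIV. M i (w' $ i) \<bullet> (?y (pa i) - v1 $ i))
      - (\<Sum>i\<in>UNIV. M i (q $ i) \<bullet> (?p i - u' $ i))
      = (\<Sum>i\<in>UNIV. M i (?s i - ?s' i) \<bullet> (?t i - ?s' i))"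
    unfolding sum.distrib[symmetric] sum_subtractf[symmetric]
  proof (rule sum.cong[OF refl])
    fix i
    \<comment> \<open>By the \<open>w\<close> update, the decrement of \<open>u - w\<close> is the
      constraint residual of the new iterate. It becomes a common factor after self-adjointness
      moves \<open>M i\<close> onto it.\<close>
    have p: "?s i - ?s' i = ?p i - u' $ i"
      by (simp add: w)
    have "M i (q $ i) \<bullet> (?p i - u' $ i) = M i (?p i - u' $ i) \<bullet> q $ i"
         "M i (w' $ i) \<bullet> (?p i - u' $ i) = M i (?p i - u' $ i) \<bullet> w' $ i"
      using M(2)[of i] by (metis self_adjoint_def inner_commute)+
    then show "M i (?p i + w' $ i - u' $ i) \<bullet> (v1 $ i - u' $ i) - M i (w' $ i) \<bullet> ?d (pa i)
        + M i (w' $ i) \<bullet> (?y (pa i) - v1 $ i) - M i (q $ i) \<bullet> (?p i - u' $ i)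
        = M i (?s i - ?s' i) \<bullet> (?t i - ?s' i)"
      unfolding p
      by (simp add: linear_diff[OF lin] linear_add[OF lin] inner_diff_left inner_diff_right
          inner_add_left inner_add_right)
  qed
  moreover have "(\<Sum>i\<in>UNIV. M i (?s i - ?s' i) \<bullet> (?t i - ?s' i))
      = (Q_norm_sq M (x - x') + Q_norm_sq M (x' - (v0, v1, q)) - Q_norm_sq M (x - (v0, v1, q))) / 2"
    unfolding self_adjoint_three_point[OF lin M(2), of _ "?s _" "?s' _" "?t _"] Q_norm_sq_eq[OF M(1)]
      x x' fst_conv snd_conv sum_divide_distrib[symmetric] sum_subtractf sum.distrib ..
  \<comment> \<open>Dropping this term of the three-point identity leaves the claimed bound.\<close>
  moreover have "0 \<le> Q_norm_sq M (x - x')"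
    using M by (intro Q_norm_sq_nonneg)
  ultimately show ?thesis
    unfolding Lagrangian_real_def x x' fst_conv snd_conv
    by (simp add: inner_commute inner_diff_right field_simps)
qed

section \<open>Averages in the Lagrangian\<close>

lemma at_node_sum:
  "at_node (\<Sum>k\<in>I. c k *\<^sub>R u0 k) (\<Sum>k\<in>I. c k *\<^sub>R u k) v = (\<Sum>k\<in>I. c k *\<^sub>R at_node (u0 k) (u k) v)"
  by (simp add: at_node_def split: option.split)

text \<open>For fixed \<open>w\<close> the expression is jointly linear in \<open>F\<close>,
  \<open>u0\<close> and \<open>u\<close>, so the weights are arbitrary.\<close>

lemma Lagrangian_real_sum_left:
  "Lagrangian_real (\<lambda>v. \<Sum>k\<in>I. c k * F k v) a pa M (\<Sum>k\<in>I. c k *\<^sub>R u0 k) (\<Sum>k\<in>I. c k *\<^sub>R u k) w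
    = (\<Sum>k\<in>I. c k * Lagrangian_real (F k) a pa M (u0 k) (u k) w)"
proof -
  have "(\<Sum>v\<in>UNIV. \<Sum>k\<in>I. c k * F k v) = (\<Sum>k\<in>I. c k * (\<Sum>v\<in>UNIV. F k v))"
    by (subst sum.swap) (simp add: sum_distrib_left)
  moreover have "(\<Sum>i\<in>UNIV. M i (w $ i) \<bullet> (at_node (\<Sum>k\<in>I. c k *\<^sub>R u0 k) (\<Sum>k\<in>I. c k *\<^sub>R u k) (pa i)
        - (\<Sum>k\<in>I. c k *\<^sub>R u k) $ i))
      = (\<Sum>k\<in>I. c k * (\<Sum>i\<in>UNIV. M i (w $ i) \<bullet> (at_node (u0 k) (u k) (pa i) - u k $ i)))"
    unfolding at_node_sum sum_distrib_left
    by (subst sum.swap)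
      (simp add: inner_sum_right inner_diff_right sum_subtractf right_diff_distrib)
  ultimately show ?thesis
    unfolding Lagrangian_real_def
    by (simp add: inner_sum_left sum.distrib sum_subtractf algebra_simps)
qed

text \<open>In \<open>w\<close> the expression is only affine: its \<open>w\<close>-free part is
  reproduced because the weights sum to 1.\<close>

lemma Lagrangian_real_sum_right:
  assumes "\<And>i. linear (M i)" and "(\<Sum>k\<in>I. c k) = 1"
  shows "Lagrangian_real F a pa M u0 u (\<Sum>k\<in>I. c k *\<^sub>R w k)
    = (\<Sum>k\<in>I. c k * Lagrangian_real F a pa M u0 u (w k))"
proof -
  have "(\<Sum>i\<in>UNIV. M i ((\<Sum>k\<in>I. c k *\<^sub>R w k) $ i) \<bullet> (at_node u0 u (pa i) - u $ i))
      = (\<Sum>k\<in>I. c k * (\<Sum>i\<in>UNIV. M i (w k $ i) \<bullet> (at_node u0 u (pa i) - u $ i)))"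
    unfolding sum_distrib_left
    by (subst sum.swap)
      (simp add: linear_sum[OF assms(1)] linear_scale[OF assms(1)] inner_sum_left)
  then show ?thesis
    unfolding Lagrangian_real_def
    by (simp add: sum.distrib distrib_left flip: sum_distrib_right) (simp add: assms(2))
qed

text \<open>A bounded linear map of \<open>w\<close> plus a constant is bounded on bounded sets;
  this keeps the supremum in the gap finite.\<close>

lemma bdd_above_Lagrangian_real:
  assumes M: "\<And>i. bounded_linear (M i)" and "bounded E"
  obtains B where "\<And>w. w \<in> E \<Longrightarrow> Lagrangian_real F a pa M u0 u w \<le> B"
proof -
  let ?h = "\<lambda>w. \<Sum>i\<in>UNIV. M i (w $ i) \<bullet> (at_node u0 u (pa i) - u $ i)"
  have "bounded_linear ?h"
    by (intro bounded_linear_sum bounded_linear_compose[OF bounded_linear_inner_left]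
        bounded_linear_compose[OF M] bounded_linear_vec_nth)
  then have "bounded (?h ` E)"
    using assms(2) by (rule bounded_linear_image[rotated])
  then obtain C where "\<And>w. w \<in> E \<Longrightarrow> \<bar>?h w\<bar> \<le> C"
    by (auto simp: bounded_iff)
  then show ?thesis
    by (intro that[of "(\<Sum>v\<in>UNIV. F v) - u0 \<bullet> a + C"])
      (fastforce simp: Lagrangian_real_def)
qed

section \<open>The ergodic bound and nonnegativity of the gap\<close>

theorem proposition5p8:
  fixes f :: "'n::finite option \<Rightarrow> 'a::{real_inner, complete_space} \<Rightarrow> ereal"
    and a :: 'a
    and pa :: "'n \<Rightarrow> 'n option"
    and M :: "'n \<Rightarrow> 'a \<Rightarrow> 'a"
    and x :: "nat \<Rightarrow> 'a \<times> ('a ^ 'n) \<times> ('a ^ 'n)"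
    and E1 :: "'a set" and E2 E3 :: "('a ^ 'n) set"
    and K :: nat
  assumes "\<And>v. proper_fun (f v)" and "\<And>v. lsc_fun (f v)" and "\<And>v. convex_fun (f v)"
    and "\<exists>u g. (\<forall>v. g v \<in> subdifferential (f v) u) \<and> a = (\<Sum>v\<in>UNIV. g v)"
    and "rooted_tree pa"
    and "\<And>i. bounded_linear (M i)" and "\<And>i. self_adjoint (M i)" and "\<And>i. uniformly_positive (M i)"
    and "uw_scheme f a pa M x"
    and "E1 \<noteq> {}" and "E2 \<noteq> {}" and "E3 \<noteq> {}" and "bounded (E1 \<times> E2 \<times> E3)"
    and "K \<ge> 1"
  shows "restricted_gap f a pa M E1 E2 E3 ((1 / real K) *\<^sub>R (\<Sum>k=1..K. x k))
           \<le> ereal (1 / (2 * real K)) * (SUP y\<in>E1 \<times> E2 \<times> E3. ereal (Q_norm_sq M (x 0 - y)))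
       \<and> ((\<exists>us0 us ws. (us0, us, ws) \<in> E1 \<times> E2 \<times> E3
              \<and> saddle_point f a pa M us0 us ws
              \<and> (us0, us, us - ws) \<in> Fix (T_uz f a pa M))
          \<longrightarrow> 0 \<le> restricted_gap f a pa M E1 E2 E3 ((1 / real K) *\<^sub>R (\<Sum>k=1..K. x k)))"
proof (intro conjI impI)
  note proper = assms(1) and conv = assms(3) and M = assms(6-8)
  \<comment> \<open>With \<open>x (Suc k)\<close> below, these indices cover the iterates 1 to
    \<open>K\<close>. The starting point, which may lie outside the domains, enters only through its
    distance.\<close>
  let ?c = "1 / real K" and ?I = "{..<K}"
  let ?r = "\<lambda>k. fst (x (Suc k))" and ?u = "\<lambda>k. fst (snd (x (Suc k)))" and ?w = "\<lambda>k. snd (snd (x (Suc k)))"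
  define au0 where "au0 = (\<Sum>k\<in>?I. ?c *\<^sub>R ?r k)"
  define au where "au = (\<Sum>k\<in>?I. ?c *\<^sub>R ?u k)"
  define aw where "aw = (\<Sum>k\<in>?I. ?c *\<^sub>R ?w k)"
  have avg: "?c *\<^sub>R (\<Sum>k=1..K. x k) = (au0, au, aw)"
    by (simp add: prod_eq_iff au0_def au_def aw_def fst_sum snd_sum scaleR_sum_right
        sum.atLeast1_atMost_eq)
  have c: "(\<Sum>k\<in>?I. ?c) = 1"
    using assms(14) by simp
  have lin: "linear (M i)" for i
    using M(1) bounded_linear.linear by blast
  have step: "uw_step f a pa M (x k) (x (Suc k))" for k
    using assms(9) by (simp add: uw_scheme_def)
  define F where "F = (\<lambda>k v. real_of_ereal (f v (at_node (?r k) (?u k) v)))"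
  have F: "f v (at_node (?r k) (?u k) v) = ereal (F k v)" for k v
  proof -
    obtain g where g: "\<And>v. g v \<in> subdifferential (f v) (at_node (?r k) (?u k) v)"
      using uw_step_subgradients[of f a pa M "fst (x k)" "fst (snd (x k))" "snd (snd (x k))" "?r k" "?u k" "?w k",
        unfolded prod.collapse, OF step M(1)] by metis
    then show ?thesis
      using subdifferential_finite[OF proper g] by (auto simp: F_def ereal_real)
  qed
  have Jensen: "f v (at_node au0 au v) \<le> ereal (\<Sum>k\<in>?I. ?c * F k v)" for v
    unfolding au0_def au_def at_node_sum
    using c F by (intro convex_fun_Jensen conv) auto
  \<comment> \<open>These are the exact values at the average, at most the averaged
    \<open>F k\<close>. Jensen's inequality and properness make them finite.\<close>
  define H where "H = (\<lambda>v. real_of_ereal (f v (at_node au0 au v)))"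
  have H: "f v (at_node au0 au v) = ereal (H v)" for v
    using Jensen[of v] proper[of v] by (auto simp: H_def proper_fun_def ereal_real)
  \<comment> \<open>The additive form avoids differences of infinite values; if the comparison point
    leaves a domain, the right side is infinite.\<close>
  have gap: "Lagrangian f a pa M au0 au q
      \<le> Lagrangian f a pa M v0 v1 aw + ereal (Q_norm_sq M (x 0 - (v0, v1, q)) / (2 * real K))" for v0 v1 q
  proof (cases "\<exists>v. f v (at_node v0 v1 v) = \<infinity>")
    case True
    then show ?thesis using Lagrangian_eq_PInfty[of f, OF proper] by fastforce
  next
    case False
    define G where "G = (\<lambda>v. real_of_ereal (f v (at_node v0 v1 v)))"
    have G: "f v (at_node v0 v1 v) = ereal (G v)" for v
      using False proper[of v] by (auto simp: G_def proper_fun_def ereal_real)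
    let ?D = "\<lambda>k. Q_norm_sq M (x k - (v0, v1, q))"
    let ?A = "\<lambda>k. Lagrangian_real (F k) a pa M (?r k) (?u k) q"
    let ?B = "\<lambda>k. Lagrangian_real G a pa M v0 v1 (?w k)"
    have "(\<Sum>k\<in>?I. ?A k - ?B k) \<le> (\<Sum>k\<in>?I. (?D k - ?D (Suc k)) / 2)"
      by (rule sum_mono, rule uw_step_gap[OF step M F G])
    also have "\<dots> = (?D 0 - ?D K) / 2"
      using sum_lessThan_telescope'[of ?D K] by (simp flip: sum_divide_distrib)
    also have "\<dots> \<le> ?D 0 / 2"
      using Q_norm_sq_nonneg[OF M(1,3)] by simp
    finally have "?c * (\<Sum>k\<in>?I. ?A k - ?B k) \<le> ?c * (?D 0 / 2)"
      by (intro mult_left_mono) auto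
    then have le: "(\<Sum>k\<in>?I. ?c * ?A k) \<le> (\<Sum>k\<in>?I. ?c * ?B k) + ?D 0 / (2 * real K)"
      unfolding sum_subtractf right_diff_distrib sum_distrib_left by simp
    have "Lagrangian f a pa M au0 au q \<le> ereal (\<Sum>k\<in>?I. ?c * ?A k)"
      using Lagrangian_le_real[of f au0 au "\<lambda>v. \<Sum>k\<in>?I. ?c * F k v", OF Jensen, of a pa M q]
      unfolding au0_def au_def Lagrangian_real_sum_left .
    moreover have "Lagrangian f a pa M v0 v1 aw = ereal (\<Sum>k\<in>?I. ?c * ?B k)"
      unfolding Lagrangian_eq_real[of f v0 v1 G, OF G] aw_def Lagrangian_real_sum_right[OF lin c] ..
    ultimately show ?thesis using le by (simp add: order_trans)
  qed
  let ?S = "SUP w'\<in>E3. Lagrangian f a pa M au0 au w'"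
  let ?N = "INF (u0', u')\<in>E1 \<times> E2. Lagrangian f a pa M u0' u' aw"
  let ?B = "SUP y\<in>E1 \<times> E2 \<times> E3. ereal (Q_norm_sq M (x 0 - y))"
  have gap_eq: "restricted_gap f a pa M E1 E2 E3 (?c *\<^sub>R (\<Sum>k=1..K. x k)) = ?S - ?N"
    unfolding avg by (simp add: restricted_gap_def)
  show "restricted_gap f a pa M E1 E2 E3 (?c *\<^sub>R (\<Sum>k=1..K. x k)) \<le> ereal (1 / (2 * real K)) * ?B"
  \<comment> \<open>An infinite supremum makes the bound trivial, as its factor is positive;
    \<open>-\<infinity>\<close> is excluded by nonemptiness.\<close>
  proof (cases ?B)
    case PInf
    then show ?thesis using assms(14) by simp
  next
    case MInf
    obtain y where "y \<in> E1 \<times> E2 \<times> E3" using assms(10-12) by blast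
    then have "ereal (Q_norm_sq M (x 0 - y)) \<le> ?B" by (rule SUP_upper)
    with MInf show ?thesis by simp
  next
    case (real b)
    let ?r = "b / (2 * real K)"
    have *: "Lagrangian f a pa M au0 au q \<le> Lagrangian f a pa M v0 v1 aw + ereal ?r"
      if "q \<in> E3" "v0 \<in> E1" "v1 \<in> E2" for q v0 v1
    proof -
      have "ereal (Q_norm_sq M (x 0 - (v0, v1, q))) \<le> ?B"
        using that by (intro SUP_upper) auto
      then have "Q_norm_sq M (x 0 - (v0, v1, q)) / (2 * real K) \<le> ?r"
        using real by (simp add: divide_right_mono)
      then show ?thesis
        using gap[of q v0 v1] by (meson add_left_mono ereal_less_eq(3) order_trans)
    qed
    have "Lagrangian f a pa M au0 au q - ereal ?r \<le> ?N" if "q \<in> E3" for q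
      using *[OF that] by (intro INF_greatest) (auto simp: ereal_minus_le_iff add.commute)
    then have "?S \<le> ?N + ereal ?r"
      by (intro SUP_least) (auto simp: ereal_minus_le_iff add.commute)
    \<comment> \<open>Passing to \<open>?S - ?N\<close> needs \<open>?S\<close> finite: for equal
      infinities the difference evaluates to \<open>\<infinity>\<close>.\<close>
    moreover have "?S \<noteq> \<infinity>"
    proof -
      have "bounded E3"
        using bounded_snd[OF bounded_snd[OF assms(13)]] assms(10,11) by simp
      then obtain C where "\<And>q. q \<in> E3 \<Longrightarrow> Lagrangian_real H a pa M au0 au q \<le> C"
        using bdd_above_Lagrangian_real[where M=M and F=H and a=a and pa=pa, OF M(1)] by metis
      then have "?S \<le> ereal C"
        by (intro SUP_least) (simp add: Lagrangian_eq_real[of f au0 au H, OF H])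
      then show ?thesis by auto
    qed
    moreover have "?S \<noteq> -\<infinity>"
    proof -
      obtain q where q: "q \<in> E3" using assms(12) by blast
      have "Lagrangian f a pa M au0 au q \<le> ?S" using q by (rule SUP_upper)
      then show ?thesis by (auto simp: Lagrangian_eq_real[of f au0 au H, OF H])
    qed
    ultimately have "?S - ?N \<le> ereal ?r"
      by (cases ?S; cases ?N) auto
    then show ?thesis unfolding gap_eq real by simp
  qed
  assume "\<exists>us0 us ws. (us0, us, ws) \<in> E1 \<times> E2 \<times> E3 \<and> saddle_point f a pa M us0 us ws
    \<and> (us0, us, us - ws) \<in> Fix (T_uz f a pa M)"
  then obtain us0 us ws where E: "us0 \<in> E1" "us \<in> E2" "ws \<in> E3" and saddle: "saddle_point f a pa M us0 us ws"
    by auto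
  have "?N \<le> Lagrangian f a pa M us0 us aw"
    using E by (intro INF_lower2[of "(us0, us)"]) auto
  also have "\<dots> \<le> Lagrangian f a pa M us0 us ws"
    using saddle by (simp add: saddle_point_def)
  also have "\<dots> \<le> Lagrangian f a pa M au0 au ws"
    using saddle by (simp add: saddle_point_def)
  also have "\<dots> \<le> ?S"
    using E(3) by (rule SUP_upper)
  \<comment> \<open>From \<open>?N \<le> ?S\<close> this also covers equal infinities, whose
    difference is \<open>\<infinity>\<close>.\<close>
  finally show "0 \<le> restricted_gap f a pa M E1 E2 E3 (?c *\<^sub>R (\<Sum>k=1..K. x k))"
    unfolding gap_eq by (cases ?S; cases ?N) auto
qed

end
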